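(* Let $0<|q|<1$ and $z\in\mathbb{C}^*$ with $z\neq1$. Then $$(z^2q^2,q^2/z^2,q^4;q^4)_\infty F_8(z,q)=\sum_{k=-\infty}^{\infty}\frac{(-1)^{k-1}q^{2k^2}}{1+q^{4k-1}}\cdot\frac{z^{1-2k}-z^{2k}}{1-z}.$$
   Context: Standard $q$-Pochhammer notation: $(a;q)_0=1$, $(a;q)_n=\prod_{k=0}^{n-1}(1-aq^k)$, $(a;q)_\infty=\prod_{k\ge0}(1-aq^k)$, $(a_1,\dots,a_m;q)_n=\prod_i(a_i;q)_n$. Define $$F_8(z,q)=\sum_{n=0}^{\infty}\frac{(-1)^n(q;q^2)_n\,q^{(n+1)^2}}{(zq,q/z;q^2)_{n+1}}.$$ *)

theory Defs
  imports "HOL-Analysis.Analysis"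
begin

definition qpoch :: "complex \<Rightarrow> complex \<Rightarrow> nat \<Rightarrow> complex" where
  "qpoch a q n = (\<Prod>k<n. 1 - a * q ^ k)"

definition qpoch_inf :: "complex \<Rightarrow> complex \<Rightarrow> complex" where
  "qpoch_inf a q = (\<Prod>k. 1 - a * q ^ k)"

definition qpochs :: "complex list \<Rightarrow> complex \<Rightarrow> nat \<Rightarrow> complex" where
  "qpochs as q n = (\<Prod>a\<leftarrow>as. qpoch a q n)"

definition qpochs_inf :: "complex list \<Rightarrow> complex \<Rightarrow> complex" where
  "qpochs_inf as q = (\<Prod>a\<leftarrow>as. qpoch_inf a q)"

text \<open>
  Since division by zero yields zero, this is the intended function only for z different from 0
  and from all odd powers (positive and negative) of q, where no denominator vanishes.
\<close>
definition F8 :: "complex \<Rightarrow> complex \<Rightarrow> complex" where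
  "F8 z q = (\<Sum>n. (-1) ^ n * qpoch q (q^2) n * q ^ ((n + 1)^2)
                    / qpochs [z * q, q / z] (q^2) (n + 1))"

end

theory Submission
  imports Defs "HOL-Complex_Analysis.Complex_Analysis"
begin

text \<open>
  Both sides, multiplied by \<open>1 - z\<close>, satisfy the first-order equation
  \<open>H (q\<^sup>2 z) + q H z = (q + 1/z) \<theta> z\<close>, where \<open>\<theta>\<close> is the triple product
  on the left. For the series side this is the Jacobi triple product, applied coefficientwise.
  For the product side, \<open>\<theta>\<close> cancels all poles of \<open>F8\<close>, and the equation
  follows by telescoping the terms of \<open>F8\<close>. The difference \<open>D\<close> of the two sides is
  holomorphic on the punctured plane with \<open>D (q\<^sup>2 z) = - q D z\<close>. It is therefore
  bounded near \<open>0\<close> and of at most linear growth, hence affine by Liouville, and so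
  \<open>D = 0\<close> because \<open>- q\<close> is neither \<open>1\<close> nor \<open>q\<^sup>2\<close>.
\<close>

section \<open>Infinite q-Pochhammer products\<close>

lemma qpoch_0 [simp]: "qpoch a q 0 = 1"
  by (simp add: qpoch_def)

lemma qpoch_Suc: "qpoch a q (Suc n) = (1 - a * q ^ n) * qpoch a q n"
  by (simp add: qpoch_def mult.commute)

lemma qpoch_Suc_shift: "qpoch a q (Suc n) = (1 - a) * qpoch (a * q) q n"
  unfolding qpoch_def by (subst prod.lessThan_Suc_shift) (simp add: ac_simps)

lemma summable_norm_qpoch:
  fixes a q :: complex
  assumes "norm q < 1"
  shows "summable (\<lambda>k. norm (a * q ^ k))"
  using assms by (simp add: norm_mult norm_power summable_mult summable_geometric)

lemma convergent_prod_qpoch: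
  fixes a q :: complex
  assumes "norm q < 1"
  shows "convergent_prod (\<lambda>k. 1 - a * q ^ k)"
proof -
  have "summable (\<lambda>k. norm ((1 - a * q ^ k) - 1))"
    using summable_norm_qpoch[OF assms, of a] by simp
  then show ?thesis
    by (intro abs_convergent_prod_imp_convergent_prod)
       (simp add: abs_convergent_prod_conv_summable)
qed

lemma qpoch_tendsto:
  assumes "norm q < 1"
  shows "(\<lambda>n. qpoch a q n) \<longlonglongrightarrow> qpoch_inf a q"
  using convergent_prod_LIMSEQ[OF convergent_prod_qpoch[OF assms, of a]]
  by (simp add: qpoch_def qpoch_inf_def LIMSEQ_lessThan_iff_atMost)

lemma qpoch_inf_rec:
  assumes "norm q < 1"
  shows "qpoch_inf a q = (1 - a) * qpoch_inf (a * q) q"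
proof (rule LIMSEQ_unique)
  show "(\<lambda>n. qpoch a q (Suc n)) \<longlonglongrightarrow> qpoch_inf a q"
    using qpoch_tendsto[OF assms] by (rule LIMSEQ_Suc)
  show "(\<lambda>n. qpoch a q (Suc n)) \<longlonglongrightarrow> (1 - a) * qpoch_inf (a * q) q"
    unfolding qpoch_Suc_shift by (intro tendsto_intros qpoch_tendsto assms)
qed

lemma qpoch_inf_split:
  assumes "norm q < 1"
  shows "qpoch_inf a q = qpoch a q n * qpoch_inf (a * q ^ n) q"
proof (induction n)
  case (Suc n)
  then show ?case
    using qpoch_inf_rec[OF assms, of "a * q ^ n"] by (simp add: qpoch_Suc ac_simps)
qed simp

lemma qpoch_self_nonzero:
  assumes "norm q < 1"
  shows "qpoch q q n \<noteq> 0"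
proof -
  have "norm (q ^ Suc k) < 1" for k
    using assms by (simp only: norm_power power_less_one_iff norm_ge_zero) simp
  then have "q * q ^ k \<noteq> 1" for k
    by (metis norm_one order_less_irrefl power_Suc)
  then show ?thesis
    by (simp add: qpoch_def)
qed

lemma qpoch_inf_self_nonzero:
  assumes "norm q < 1"
  shows "qpoch_inf q q \<noteq> 0"
  unfolding qpoch_inf_def
proof (rule prodinf_nonzero[OF convergent_prod_qpoch[OF assms]])
  show "1 - q * q ^ k \<noteq> 0" for k
    using qpoch_self_nonzero[OF assms, of "Suc k"] by (simp add: qpoch_Suc)
qed

text \<open>Factorwise \<open>1 + t \<le> exp t\<close>, then a geometric series in the exponent.
  The bound is free of \<open>n\<close>, so it passes to the infinite product and feeds the
  majorants for \<open>jacobi_coeff\<close> and \<open>reg_term\<close>.\<close>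

lemma norm_qpoch_le:
  assumes "norm q < 1"
  shows "norm (qpoch a q n) \<le> exp (norm a / (1 - norm q))"
proof -
  have "norm (qpoch a q n) = (\<Prod>k<n. norm (1 - a * q ^ k))"
    by (simp add: qpoch_def prod_norm)
  also have "\<dots> \<le> (\<Prod>k<n. exp (norm (a * q ^ k)))"
  proof (rule prod_mono, safe)
    fix k
    have "norm (1 - a * q ^ k) \<le> 1 + norm (a * q ^ k)"
      using norm_triangle_ineq4[of 1 "a * q ^ k"] by simp
    then show "norm (1 - a * q ^ k) \<le> exp (norm (a * q ^ k))"
      using exp_ge_add_one_self[of "norm (a * q ^ k)"] by linarith
  qed simp
  also have "\<dots> = exp (\<Sum>k<n. norm (a * q ^ k))"
    by (simp add: exp_sum)
  also have "(\<Sum>k<n. norm (a * q ^ k)) \<le> (\<Sum>k. norm (a * q ^ k))"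
    by (intro sum_le_suminf summable_norm_qpoch assms) auto
  also have "(\<Sum>k. norm (a * q ^ k)) = norm a / (1 - norm q)"
    using assms by (simp add: norm_mult norm_power suminf_mult suminf_geometric)
  finally show ?thesis by simp
qed

lemma norm_qpoch_inf_le:
  assumes "norm q < 1"
  shows "norm (qpoch_inf a q) \<le> exp (norm a / (1 - norm q))"
  by (rule Lim_bounded[OF tendsto_norm[OF qpoch_tendsto[OF assms]]]) (use norm_qpoch_le[OF assms] in auto)

text \<open>The factors pair up as differences of squares. This splits \<open>theta_prod\<close>, a
  product to the base \<open>q ^ 4\<close>, into products to the base \<open>q ^ 2\<close>.\<close>

lemma qpoch_inf_square:
  assumes "norm q < 1"
  shows "qpoch_inf (a ^ 2) (q ^ 2) = qpoch_inf a q * qpoch_inf (- a) q"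
proof -
  have "qpoch_inf a q * qpoch_inf (- a) q
      = (\<Prod>k. (1 - a * q ^ k) * (1 - (- a) * q ^ k))"
    unfolding qpoch_inf_def by (intro prodinf_mult convergent_prod_qpoch assms)
  also have "(\<lambda>k. (1 - a * q ^ k) * (1 - (- a) * q ^ k)) = (\<lambda>k. 1 - a ^ 2 * (q ^ 2) ^ k)"
    by (auto simp: algebra_simps power2_eq_square power_mult_distrib)
  finally show ?thesis
    by (simp add: qpoch_inf_def)
qed

section \<open>Holomorphy of products and sums, and a uniqueness principle for multiplicative
  shifts\<close>

lemma holomorphic_qpoch_inf_UNIV:
  assumes "norm q < 1"
  shows "(\<lambda>a. qpoch_inf a q) holomorphic_on UNIV"
proof (rule holomorphic_uniform_sequence)
  show "(\<lambda>a. qpoch a q n) holomorphic_on UNIV" for n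
    unfolding qpoch_def by (intro holomorphic_intros)
  fix x :: complex
  have "uniformly_convergent_on (cball x 1) (\<lambda>n a. \<Prod>k<n. 1 - a * q ^ k)"
  proof (rule uniformly_convergent_on_prod')
    show "uniformly_convergent_on (cball x 1) (\<lambda>N a. \<Sum>n<N. norm ((1 - a * q ^ n) - 1))"
    proof (rule Weierstrass_m_test'[where M = "\<lambda>n. (norm x + 1) * norm q ^ n"])
      fix n a assume "a \<in> cball x 1"
      then have "norm a \<le> norm x + 1"
        using norm_triangle_ineq2[of a x] by (simp add: dist_norm norm_minus_commute)
      then show "norm (norm ((1 - a * q ^ n) - 1)) \<le> (norm x + 1) * norm q ^ n"
        by (simp add: norm_mult norm_power mult_right_mono)
    qed (use assms in \<open>auto intro!: summable_mult summable_geometric\<close>)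
  qed (auto intro!: continuous_intros)
  then have "uniform_limit (cball x 1) (\<lambda>n a. qpoch a q n) (\<lambda>a. lim (\<lambda>n. qpoch a q n)) sequentially"
    unfolding qpoch_def by (simp add: uniformly_convergent_uniform_limit_iff)
  also have "(\<lambda>a. lim (\<lambda>n. qpoch a q n)) = (\<lambda>a. qpoch_inf a q)"
    using qpoch_tendsto[OF assms] by (auto simp: limI)
  finally show "\<exists>d>0. cball x d \<subseteq> UNIV \<and>
      uniform_limit (cball x d) (\<lambda>n a. qpoch a q n) (\<lambda>a. qpoch_inf a q) sequentially"
    by (intro exI[of _ 1]) auto
qed auto

lemma holomorphic_qpoch_inf [holomorphic_intros]:
  assumes "norm q < 1" "f holomorphic_on S"
  shows "(\<lambda>z. qpoch_inf (f z) q) holomorphic_on S"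
  using holomorphic_on_compose[OF assms(2) holomorphic_on_subset[OF holomorphic_qpoch_inf_UNIV[OF assms(1)]]]
  by (simp add: o_def)

text \<open>A local summable majorant makes the finite partial sums converge uniformly on small
  balls. The index set is arbitrary so that the lemma serves both \<open>reg_sum\<close> (naturals)
  and \<open>half_lerch\<close> (integers).\<close>

lemma holomorphic_infsum:
  fixes f :: "'a \<Rightarrow> complex \<Rightarrow> complex"
  assumes S: "open S"
    and hol: "\<And>k. k \<in> I \<Longrightarrow> f k holomorphic_on S"
    and bound: "\<And>z. z \<in> S \<Longrightarrow> \<exists>d M. 0 < d \<and> cball z d \<subseteq> S \<and> M summable_on I \<and>
                  (\<forall>k\<in>I. \<forall>w\<in>cball z d. norm (f k w) \<le> M k)"
  shows "(\<lambda>z. infsum (\<lambda>k. f k z) I) holomorphic_on S"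
proof -
  have "\<exists>d>0. (\<lambda>z. infsum (\<lambda>k. f k z) I) holomorphic_on ball z d" if z: "z \<in> S" for z
  proof -
    obtain d M where d: "0 < d" "cball z d \<subseteq> S" and M: "M summable_on I"
      and le: "\<And>k w. k \<in> I \<Longrightarrow> w \<in> cball z d \<Longrightarrow> norm (f k w) \<le> M k"
      using bound[OF z] by blast
    have lim: "uniform_limit (cball z d) (\<lambda>X w. \<Sum>k\<in>X. f k w) (\<lambda>w. infsum (\<lambda>k. f k w) I)
                 (finite_subsets_at_top I)"
      using le M by (rule Weierstrass_m_test_general)
    have "\<forall>\<^sub>F X in finite_subsets_at_top I. finite X \<and> X \<subseteq> I"
      by (rule eventually_finite_subsets_at_top_weakI) auto
    then have "\<forall>\<^sub>F X in finite_subsets_at_top I.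
        continuous_on (cball z d) (\<lambda>w. \<Sum>k\<in>X. f k w) \<and> (\<lambda>w. \<Sum>k\<in>X. f k w) holomorphic_on ball z d"
    proof eventually_elim
      case (elim X)
      then have "(\<lambda>w. \<Sum>k\<in>X. f k w) holomorphic_on S"
        by (intro holomorphic_on_sum hol) auto
      then show ?case
        using d ball_subset_cball[of z d]
        by (meson holomorphic_on_imp_continuous_on holomorphic_on_subset order_trans)
    qed
    from holomorphic_uniform_limit[OF this lim] d show ?thesis
      by auto
  qed
  then show ?thesis
    by (metis S centre_in_ball holomorphic_on_def at_within_open field_differentiable_at_within open_ball)
qed

text \<open>Iterating towards \<open>0\<close> multiplies by powers of \<open>c\<close>, so
  \<open>norm c < 1\<close> keeps \<open>f\<close> bounded there; iterating outwards divides by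
  powers of \<open>c\<close>, and \<open>norm p < norm c\<close> keeps the growth at most linear.
  The extension of \<open>f\<close> is therefore affine, and the equation kills both coefficients
  since \<open>c\<close> is neither \<open>1\<close> nor \<open>p\<close>.\<close>

lemma holomorphic_eigenfunction_eq_0:
  fixes f :: "complex \<Rightarrow> complex"
  assumes hol: "f holomorphic_on -{0}"
    and eq: "\<And>z. z \<noteq> 0 \<Longrightarrow> f (p * z) = c * f z"
    and pc: "0 < norm p" "norm p < norm c" "norm c < 1"
    and z: "z \<noteq> 0"
  shows "f z = 0"
proof -
  \<comment> \<open>This annulus meets every nonzero orbit of multiplication by \<open>p\<close>, so
    a bound on it controls \<open>f\<close> everywhere.\<close>
  define A where "A = cball (0::complex) 1 - ball 0 (norm p)"
  have "compact A"
    unfolding A_def by (intro compact_diff) auto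
  moreover have "continuous_on A f"
    using pc by (intro continuous_on_subset[OF holomorphic_on_imp_continuous_on[OF hol]])
                (auto simp: A_def)
  ultimately have "bounded (f ` A)"
    by (intro compact_imp_bounded compact_continuous_image)
  then obtain M where M: "\<And>w. w \<in> A \<Longrightarrow> norm (f w) \<le> M"
    by (auto simp: bounded_iff)
  have iter: "f (p ^ n * w) = c ^ n * f w" if "w \<noteq> 0" for n w
  proof (induction n)
    case (Suc n)
    have "f (p ^ Suc n * w) = c * f (p ^ n * w)"
      using eq[of "p ^ n * w"] that pc by (auto simp: ac_simps)
    then show ?case by (simp add: Suc)
  qed simp
  have p1: "norm p < 1" using pc by linarith
  have small: "norm (f w) \<le> M" if w: "w \<noteq> 0" "norm w \<le> 1" for w
  proof -
    have "\<exists>n. norm p ^ Suc n < norm w"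
    proof -
      obtain n where n: "norm p ^ n < norm w"
        using real_arch_pow_inv[of "norm w" "norm p"] w p1 by auto
      have "norm p ^ Suc n \<le> norm p ^ n"
        using p1 by (intro power_decreasing) auto
      with n show ?thesis by (intro exI[of _ n]) linarith
    qed
    \<comment> \<open>Minimality gives |p|^(n+1) < |w| <= |p|^n, which places
      \<open>w / p ^ n\<close> in the annulus.\<close>
    define n where "n = (LEAST n. norm p ^ Suc n < norm w)"
    have n: "norm p ^ Suc n < norm w"
      unfolding n_def by (rule LeastI_ex) fact
    have n': "norm w \<le> norm p ^ n"
    proof (cases n)
      case (Suc m)
      then have "\<not> norm p ^ Suc m < norm w"
        unfolding n_def by (intro not_less_Least) simp
      then show ?thesis using Suc by simp
    qed (use w in simp)
    define v where "v = w / p ^ n"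
    have v: "w = p ^ n * v" using pc by (auto simp: v_def)
    have "v \<in> A"
      using n n' pc by (auto simp: A_def v_def norm_divide norm_power field_simps)
    have "v \<noteq> 0" using v w by auto
    have "norm (f w) = norm c ^ n * norm (f v)"
      unfolding v iter[OF \<open>v \<noteq> 0\<close>] by (simp add: norm_mult norm_power)
    also have "\<dots> \<le> 1 * M"
      using M[OF \<open>v \<in> A\<close>] pc by (intro mult_mono power_le_one) auto
    finally show ?thesis by simp
  qed
  have large: "norm (f w) \<le> (M / norm p) * norm w" if w: "norm w \<ge> 1" for w
  proof -
    have "\<exists>n. norm p ^ n * norm w \<le> 1"
    proof -
      obtain n where "norm p ^ n < 1 / norm w"
        using real_arch_pow_inv[of "1 / norm w" "norm p"] w p1
        by (metis less_le_trans zero_less_divide_1_iff zero_less_one)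
      then have "norm p ^ n * norm w < 1"
        using w by (subst (asm) pos_less_divide_eq) auto
      then show ?thesis
        by (intro exI[of _ n]) simp
    qed
    \<comment> \<open>Minimality gives |p| <= |p^n w| <= 1; for \<open>n = 0\<close> the lower bound
      comes from |w| >= 1.\<close>
    define n where "n = (LEAST n. norm p ^ n * norm w \<le> 1)"
    have n: "norm p ^ n * norm w \<le> 1"
      unfolding n_def by (rule LeastI_ex) fact
    have n': "norm p \<le> norm p ^ n * norm w"
    proof (cases n)
      case (Suc m)
      then have "\<not> norm p ^ m * norm w \<le> 1"
        unfolding n_def by (intro not_less_Least) simp
      then have "norm p * 1 \<le> norm p * (norm p ^ m * norm w)"
        by (intro mult_left_mono) auto
      then show ?thesis using Suc by (simp add: mult.assoc)
    qed (use w p1 in simp)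
    have "p ^ n * w \<in> A"
      using n n' by (auto simp: A_def norm_mult norm_power)
    have "w \<noteq> 0" using w by auto
    have "norm c ^ n * norm (f w) \<le> M"
      using M[OF \<open>p ^ n * w \<in> A\<close>] iter[OF \<open>w \<noteq> 0\<close>, of n] by (simp add: norm_mult norm_power)
    moreover have "norm p ^ n * norm (f w) \<le> norm c ^ n * norm (f w)"
      using pc by (intro mult_right_mono power_mono) auto
    ultimately have "norm p ^ n * norm (f w) \<le> M" by linarith
    then have "norm w * (norm p ^ n * norm (f w)) \<le> norm w * M"
      by (intro mult_left_mono) auto
    moreover have "norm p * norm (f w) \<le> (norm p ^ n * norm w) * norm (f w)"
      using n' by (intro mult_right_mono) auto
    ultimately have "norm p * norm (f w) \<le> norm w * M"
      by (simp add: ac_simps)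
    then show ?thesis
      using pc by (simp add: field_simps)
  qed
  have "\<forall>\<^sub>F w in at 0. norm (f w) \<le> M"
    unfolding eventually_at using small by (intro exI[of _ 1]) auto
  moreover have "f holomorphic_on UNIV - {0}"
    using hol by (simp add: Compl_eq_Diff_UNIV)
  ultimately obtain g where g: "g holomorphic_on UNIV" "\<And>w. w \<noteq> 0 \<Longrightarrow> g w = f w"
    using holomorphic_on_extend_bounded[of f UNIV 0] by auto
  \<comment> \<open>The exponent \<open>1\<close> is written out so that
    \<open>Liouville_polynomial\<close> yields a polynomial of degree at most one.\<close>
  have "norm (g w) \<le> (M / norm p) * norm w ^ 1" if "1 \<le> norm w" for w
    using large[OF that] g(2)[of w] that by fastforce
  note poly = Liouville_polynomial[OF g(1) this]
  define a where "a = g 0"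
  define b where "b = deriv g 0"
  have ab: "g w = a + b * w" for w
    using poly[where \<xi> = w] by (simp add: a_def b_def)
  have lin: "(1 - c) * a + (p - c) * b * w = 0" if "w \<noteq> 0" for w
  proof -
    have "a + b * (p * w) = c * (a + b * w)"
      using eq[OF that] g(2)[of w] g(2)[of "p * w"] ab that pc by auto
    then show ?thesis by (simp add: algebra_simps)
  qed
  \<comment> \<open>The instances at \<open>1\<close> and \<open>-1\<close> separate the two
    coefficients by addition and subtraction.\<close>
  have "(1 - c) * a = 0" "(p - c) * b = 0"
    using lin[of 1] lin[of "-1"] by auto
  moreover have "c \<noteq> 1" "p \<noteq> c" using pc by auto
  ultimately have "a = 0" "b = 0" by auto
  then show ?thesis
    using ab[of z] g(2)[OF z] by simp
qed

section \<open>The Jacobi triple product\<close>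

text \<open>The term is the \<open>n\<close>-th power of \<open>a ^ n * r\<close>, and this base
  tends to \<open>0\<close>, so a geometric series with ratio 1/2 eventually dominates.\<close>

lemma summable_power_square_nat:
  fixes a r :: real
  assumes "0 \<le> a" "a < 1"
  shows "summable (\<lambda>n. a ^ (n ^ 2) * r ^ n)"
proof (rule summable_comparison_test_ev)
  have "(\<lambda>n. a ^ n * \<bar>r\<bar>) \<longlonglongrightarrow> 0 * \<bar>r\<bar>"
    using assms by (intro tendsto_intros LIMSEQ_realpow_zero)
  then have "eventually (\<lambda>n. a ^ n * \<bar>r\<bar> < 1 / 2) sequentially"
    by (rule order_tendstoD) auto
  then show "eventually (\<lambda>n. norm (a ^ (n ^ 2) * r ^ n) \<le> (1 / 2) ^ n) sequentially"
  proof eventually_elim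
    case (elim n)
    have "norm (a ^ (n ^ 2) * r ^ n) = (a ^ n * \<bar>r\<bar>) ^ n"
      using assms by (simp add: power2_eq_square power_mult power_mult_distrib abs_mult power_abs)
    also have "\<dots> \<le> (1 / 2) ^ n"
      using elim assms by (intro power_mono) auto
    finally show ?case .
  qed
qed (simp add: summable_geometric)

lemma summable_power_square_int:
  fixes a r :: real
  assumes "0 \<le> a" "a < 1" "0 \<le> r"
  shows "(\<lambda>k::int. a powi (k ^ 2) * r ^ nat \<bar>k\<bar>) summable_on UNIV"
proof -
  have nat: "(\<lambda>n. a ^ (n ^ 2) * r ^ n) summable_on UNIV"
    using summable_power_square_nat[of a r] assms by (subst summable_on_UNIV_nonneg_real_iff) auto
  let ?f = "\<lambda>k::int. a powi (k ^ 2) * r ^ nat \<bar>k\<bar>"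
  have pw: "a powi ((int n) ^ 2) = a ^ (n ^ 2)" for n
    by (metis of_nat_power power_int_of_nat)
  have "?f summable_on range int" "?f summable_on range (\<lambda>n. - int n)"
    using nat by (subst summable_on_reindex; auto simp: inj_on_def o_def pw)+
  moreover have "(UNIV :: int set) = range int \<union> range (\<lambda>n. - int n)"
    by (auto, metis int_cases2 rangeI)
  ultimately show ?thesis
    by (metis summable_on_union)
qed

text \<open>A single \<open>r\<close> bounding both |x| and 1/|x| covers positive and negative
  exponents at once, which gives majorants for bilateral series.\<close>

lemma norm_power_int_le:
  fixes x :: complex
  assumes "norm x \<le> r" "1 / norm x \<le> r" "x \<noteq> 0"
  shows "norm (x powi k) \<le> r ^ nat \<bar>k\<bar>"
proof (cases "k \<ge> 0")
  case True
  then show ?thesis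
    using assms by (simp add: power_int_def norm_power power_mono)
next
  case False
  then show ?thesis
    using assms by (simp add: power_int_def norm_power norm_divide power_mono inverse_eq_divide)
qed

section \<open>Gaussian binomial coefficients and the finite triple product\<close>

text \<open>Extending \<open>1 / (p;p)\<^sub>m\<close> by \<open>0\<close> to negative \<open>m\<close> lets the recurrences below hold without boundary cases.\<close>

definition inv_qpoch :: "complex \<Rightarrow> int \<Rightarrow> complex" where
  "inv_qpoch p m = (if m < 0 then 0 else 1 / qpoch p p (nat m))"

text \<open>At \<open>m = 0\<close> the factor \<open>1 - p powi m\<close> vanishes, in agreement
  with the value \<open>0\<close> at \<open>-1\<close>; this is why the recurrence holds for all
  integers.\<close>

lemma inv_qpoch_pred:
  assumes "norm p < 1"
  shows "inv_qpoch p (m - 1) = (1 - p powi m) * inv_qpoch p m"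
proof (cases "m \<le> 0")
  case False
  then obtain n where n: "m = int (Suc n)"
    by (metis gr0_implies_Suc not_le of_nat_0_less_iff zero_less_imp_eq_int)
  have m1: "m - 1 = int n" by (simp add: n)
  have "p powi m = p * p ^ n"
    unfolding n power_int_of_nat by simp
  moreover have "qpoch p p (Suc n) \<noteq> 0" "qpoch p p n \<noteq> 0"
    using qpoch_self_nonzero[OF assms] by blast+
  ultimately show ?thesis
    unfolding m1 unfolding inv_qpoch_def n nat_int
    by (simp add: qpoch_Suc field_simps)
qed (auto simp: inv_qpoch_def)

lemma inv_qpoch_bounded:
  assumes "norm p < 1"
  obtains B where "\<And>m. norm (inv_qpoch p m) \<le> B" "B \<ge> 0"
proof -
  have "(\<lambda>n. 1 / qpoch p p n) \<longlonglongrightarrow> 1 / qpoch_inf p p"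
    by (intro tendsto_intros qpoch_tendsto qpoch_inf_self_nonzero assms)
  then have "Bseq (\<lambda>n. 1 / qpoch p p n)"
    by (intro convergent_imp_Bseq convergentI)
  then obtain B where "B > 0" "\<And>n. norm (1 / qpoch p p n) \<le> B"
    by (auto simp: Bseq_def)
  then show thesis
    by (intro that[of B]) (auto simp: inv_qpoch_def)
qed

lemma inv_qpoch_tendsto:
  assumes "norm p < 1"
  shows "(inv_qpoch p \<longlongrightarrow> 1 / qpoch_inf p p) at_top"
proof -
  have "filterlim nat sequentially at_top"
    by (rule filterlim_nat_sequentially)
  moreover have "(\<lambda>n. 1 / qpoch p p n) \<longlonglongrightarrow> 1 / qpoch_inf p p"
    by (intro tendsto_intros qpoch_tendsto qpoch_inf_self_nonzero assms)
  ultimately have "((\<lambda>m. 1 / qpoch p p (nat m)) \<longlongrightarrow> 1 / qpoch_inf p p) at_top"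
    by (rule filterlim_compose[rotated])
  then show ?thesis
  proof (rule Lim_transform_eventually)
    show "\<forall>\<^sub>F m in at_top. 1 / qpoch p p (nat m) = inv_qpoch p m"
      using eventually_ge_at_top[of "0::int"] by eventually_elim (simp add: inv_qpoch_def)
  qed
qed

text \<open>The central Gaussian binomial coefficient \<open>2N\<close> over \<open>N + k\<close>, which vanishes for \<open>\<bar>k\<bar> > N\<close>.\<close>

definition jacobi_coeff :: "complex \<Rightarrow> nat \<Rightarrow> int \<Rightarrow> complex" where
  "jacobi_coeff p N k = qpoch p p (2 * N) * inv_qpoch p (int N - k) * inv_qpoch p (int N + k)"

text \<open>With \<open>p = q ^ 2\<close> this is the coefficient form of multiplying the finite
  product by its two new factors, whose product is 1 + p Q^2 - q Q x - q Q / x.\<close>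

lemma jacobi_coeff_Suc:
  fixes p :: complex and N :: nat and k :: int
  assumes p: "norm p < 1" "p \<noteq> 0"
  defines "Q \<equiv> p ^ N" and "Y \<equiv> p powi k"
  shows "jacobi_coeff p (Suc N) k = (1 + p * Q ^ 2) * jacobi_coeff p N k
           + p * Q / Y * jacobi_coeff p N (k - 1) + p * Q * Y * jacobi_coeff p N (k + 1)"
proof -
  \<comment> \<open>\<open>a\<close> and \<open>b\<close> sit at the largest arguments that occur;
    every other value is a polynomial multiple of one of them, so only a rational identity
    remains.\<close>
  define a where "a = inv_qpoch p (int N + 1 - k)"
  define b where "b = inv_qpoch p (int N + 1 + k)"
  have Y: "Y \<noteq> 0" using p by (simp add: Y_def)
  have pw: "p powi (int N + 1 - k) = p * Q / Y" "p powi (int N + 1 + k) = p * Q * Y"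
    "p powi (int N - k) = Q / Y" "p powi (int N + k) = Q * Y"
    using p by (simp_all add: power_int_diff power_int_add Q_def Y_def)
  have 1: "inv_qpoch p (int N - k) = (1 - p * Q / Y) * a"
    using inv_qpoch_pred[OF p(1), of "int N + 1 - k"] by (simp add: pw a_def)
  have 2: "inv_qpoch p (int N + k) = (1 - p * Q * Y) * b"
    using inv_qpoch_pred[OF p(1), of "int N + 1 + k"] by (simp add: pw b_def)
  have 3: "inv_qpoch p (int N - (k + 1)) = (1 - Q / Y) * ((1 - p * Q / Y) * a)"
    using inv_qpoch_pred[OF p(1), of "int N - k"] by (simp add: pw 1 algebra_simps)
  have 4: "inv_qpoch p (int N + (k - 1)) = (1 - Q * Y) * ((1 - p * Q * Y) * b)"
    using inv_qpoch_pred[OF p(1), of "int N + k"] unfolding pw 2 by (simp add: add_diff_eq)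
  have 5: "inv_qpoch p (int N - (k - 1)) = a" "inv_qpoch p (int N + (k + 1)) = b"
    "inv_qpoch p (int (Suc N) - k) = a" "inv_qpoch p (int (Suc N) + k) = b"
    unfolding a_def b_def by (simp_all add: algebra_simps)
  have 6: "qpoch p p (2 * Suc N) = (1 - p ^ 2 * Q ^ 2) * (1 - p * Q ^ 2) * qpoch p p (2 * N)"
  proof -
    have "p ^ (2 * N) = Q ^ 2" by (simp add: Q_def power_even_eq)
    then show ?thesis by (simp add: qpoch_Suc power2_eq_square mult.assoc)
  qed
  define C where "C = qpoch p p (2 * N) * a * b"
  \<comment> \<open>Naming the inverse turns the rational identity into a polynomial one modulo
    \<open>Y * y = 1\<close>.\<close>
  define y where "y = inverse Y"
  have y: "Y * y = 1" using Y by (simp add: y_def)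
  have "jacobi_coeff p (Suc N) k = ((1 - p ^ 2 * Q ^ 2) * (1 - p * Q ^ 2)) * C"
    unfolding jacobi_coeff_def 5 6 C_def by simp
  also have "(1 - p ^ 2 * Q ^ 2) * (1 - p * Q ^ 2)
     = (1 + p * Q ^ 2) * ((1 - p * Q * y) * (1 - p * Q * Y))
       + p * Q * y * ((1 - Q * Y) * (1 - p * Q * Y)) + p * Q * Y * ((1 - Q * y) * (1 - p * Q * y))"
    using y by algebra
  also have "\<dots> * C = (1 + p * Q ^ 2) * jacobi_coeff p N k
           + p * Q / Y * jacobi_coeff p N (k - 1) + p * Q * Y * jacobi_coeff p N (k + 1)"
    unfolding jacobi_coeff_def 1 2 3 4 5 C_def divide_inverse y_def[symmetric]
    by (simp only: distrib_left distrib_right mult_ac)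
  finally show ?thesis .
qed

lemma power_int_square_shift:
  fixes q :: complex
  assumes "q \<noteq> 0"
  shows "q powi ((k - 1) ^ 2) = q powi (k ^ 2) * q / (q ^ 2) powi k"
    and "q powi ((k + 1) ^ 2) = q powi (k ^ 2) * q * (q ^ 2) powi k"
proof -
  have 1: "(q ^ 2) powi k = q powi (2 * k)"
    by (simp add: power_int_mult)
  have 2: "(k - 1) ^ 2 = k ^ 2 + 1 - 2 * k" "(k + 1) ^ 2 = k ^ 2 + 1 + 2 * k"
    by (simp_all add: power2_eq_square algebra_simps)
  show "q powi ((k - 1) ^ 2) = q powi (k ^ 2) * q / (q ^ 2) powi k"
    unfolding 1 2 using assms by (simp add: power_int_add power_int_diff)
  show "q powi ((k + 1) ^ 2) = q powi (k ^ 2) * q * (q ^ 2) powi k"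
    unfolding 1 2 using assms by (simp add: power_int_add power_int_diff)
qed

text \<open>Induction on \<open>N\<close>: multiplying by \<open>x\<close> or \<open>1 / x\<close>
  shifts \<open>k\<close> by one, and a sum over all integers is invariant under such shifts. The
  vanishing of the coefficients for |k| > N avoids any range bookkeeping.\<close>

lemma finite_jacobi_triple_product:
  fixes q x :: complex
  assumes q: "norm q < 1" "q \<noteq> 0" and x: "x \<noteq> 0"
  shows "((\<lambda>k. (-1) powi k * q powi (k ^ 2) * x powi k * jacobi_coeff (q ^ 2) N k)
            has_sum qpoch (x * q) (q ^ 2) N * qpoch (q / x) (q ^ 2) N) UNIV"
proof (induction N)
  case 0
  \<comment> \<open>For \<open>N = 0\<close> only \<open>k = 0\<close> survives, since otherwise
    \<open>k\<close> or \<open>- k\<close> is negative.\<close>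
  have "((\<lambda>k. (-1) powi k * q powi (k ^ 2) * x powi k * jacobi_coeff (q ^ 2) 0 k)
            has_sum (\<Sum>k\<in>{0::int}. (-1) powi k * q powi (k ^ 2) * x powi k * jacobi_coeff (q ^ 2) 0 k)) {0}"
    by (rule has_sum_finite) simp
  also have "?this \<longleftrightarrow> ((\<lambda>k. (-1) powi k * q powi (k ^ 2) * x powi k * jacobi_coeff (q ^ 2) 0 k)
            has_sum (\<Sum>k\<in>{0::int}. (-1) powi k * q powi (k ^ 2) * x powi k * jacobi_coeff (q ^ 2) 0 k)) UNIV"
    by (rule has_sum_cong_neutral) (auto simp: jacobi_coeff_def inv_qpoch_def)
  finally show ?case
    by (simp add: jacobi_coeff_def inv_qpoch_def)
next
  case (Suc N)
  define p where "p = q ^ 2"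
  have p: "norm p < 1" "p \<noteq> 0"
    using q by (auto simp: p_def norm_power power_less_one_iff)
  define E where "E k = (-1) powi k * q powi (k ^ 2) * x powi k" for k :: int
  define t where "t M k = E k * jacobi_coeff p M k" for M k
  define P where "P M = qpoch (x * q) p M * qpoch (q / x) p M" for M
  have IH: "(t N has_sum P N) UNIV"
    using Suc by (simp add: t_def[abs_def] E_def P_def p_def)
  have E_pred: "E (k - 1) = - E k * q / (x * p powi k)"
    and E_succ: "E (k + 1) = - E k * q * x * p powi k" for k
    unfolding E_def power_int_square_shift[OF q(2)] p_def using q x
    by (simp_all add: power_int_diff power_int_add ac_simps)
  have s1: "((\<lambda>k. t N (k - 1)) has_sum P N) UNIV"
    using IH by (subst has_sum_reindex_bij_witness[of _ "\<lambda>k. k + 1" "\<lambda>k. k - 1" UNIV]) auto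
  have s2: "((\<lambda>k. t N (k + 1)) has_sum P N) UNIV"
    using IH by (subst has_sum_reindex_bij_witness[of _ "\<lambda>k. k - 1" "\<lambda>k. k + 1" UNIV]) auto
  have "((\<lambda>k. (1 + p * (p ^ N) ^ 2) * t N k + (- q * p ^ N * x) * t N (k - 1)
              + (- q * p ^ N / x) * t N (k + 1))
         has_sum ((1 + p * (p ^ N) ^ 2) * P N + (- q * p ^ N * x) * P N + (- q * p ^ N / x) * P N)) UNIV"
    by (intro has_sum_add has_sum_cmult_right IH s1 s2)
  also have "(\<lambda>k. (1 + p * (p ^ N) ^ 2) * t N k + (- q * p ^ N * x) * t N (k - 1)
              + (- q * p ^ N / x) * t N (k + 1)) = t (Suc N)"
  proof
    fix k
    have "p powi k \<noteq> 0" using p by simp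
    then show "(1 + p * (p ^ N) ^ 2) * t N k + (- q * p ^ N * x) * t N (k - 1)
              + (- q * p ^ N / x) * t N (k + 1) = t (Suc N) k"
      unfolding t_def jacobi_coeff_Suc[OF p] E_pred E_succ using x
      by (simp add: field_simps) (simp add: p_def power2_eq_square algebra_simps)
  qed
  also have "(1 + p * (p ^ N) ^ 2) * P N + (- q * p ^ N * x) * P N + (- q * p ^ N / x) * P N = P (Suc N)"
    unfolding P_def qpoch_Suc using x
    by (simp add: field_simps) (simp add: p_def power2_eq_square algebra_simps)
  finally show ?case
    by (simp add: t_def[abs_def] E_def P_def p_def)
qed

lemma summable_on_theta_bound:
  fixes q :: complex and r :: real
  assumes "norm q < 1" "0 \<le> r"
  shows "(\<lambda>k::int. norm q powi (k ^ 2) * r ^ nat \<bar>k\<bar>) summable_on UNIV"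
  using assms by (intro summable_power_square_int) auto

text \<open>The limit of the finite version as \<open>N\<close> grows: each coefficient tends to
  \<open>1 / L\<close> and all are bounded by a constant free of \<open>N\<close> and
  \<open>k\<close>, so dominated convergence for series applies.\<close>

lemma jacobi_triple_product:
  fixes q x :: complex
  assumes q: "norm q < 1" "q \<noteq> 0" and x: "x \<noteq> 0"
  shows "((\<lambda>k. (-1) powi k * q powi (k ^ 2) * x powi k)
            has_sum qpochs_inf [x * q, q / x, q ^ 2] (q ^ 2)) UNIV"
proof -
  define p where "p = q ^ 2"
  have p: "norm p < 1" "p \<noteq> 0"
    using q by (auto simp: p_def norm_power power_less_one_iff)
  define L where "L = qpoch_inf p p"
  have L: "L \<noteq> 0"
    unfolding L_def by (intro qpoch_inf_self_nonzero p)
  define E where "E k = (-1) powi k * q powi (k ^ 2) * x powi k" for k :: int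
  define P where "P N = qpoch (x * q) p N * qpoch (q / x) p N" for N
  define r where "r = max (norm x) (1 / norm x)"
  have r: "norm x \<le> r" "1 / norm x \<le> r" "0 \<le> r"
    by (auto simp: r_def le_max_iff_disj)
  have norm_E: "norm (E k) \<le> norm q powi (k ^ 2) * r ^ nat \<bar>k\<bar>" for k
    using norm_power_int_le[OF r(1,2) x, of k]
    by (auto simp: E_def norm_mult norm_power_int intro!: mult_left_mono)
  obtain B where B: "\<And>m. norm (inv_qpoch p m) \<le> B" "B \<ge> 0"
    using inv_qpoch_bounded[OF p(1)] by blast
  define K where "K = exp (norm p / (1 - norm p)) * B * B"
  have norm_coeff: "norm (jacobi_coeff p N k) \<le> K" for N k
    unfolding jacobi_coeff_def K_def norm_mult using B norm_qpoch_le[OF p(1)]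
    by (intro mult_mono) auto
  have coeff_lim: "(\<lambda>N. jacobi_coeff p N k) \<longlonglongrightarrow> 1 / L" for k
  proof -
    have "filterlim (\<lambda>N. int N + j) at_top sequentially" for j
      unfolding filterlim_at_top eventually_at_top_linorder
    proof
      fix Z :: int
      show "\<exists>M. \<forall>n\<ge>M. Z \<le> int n + j"
        by (intro exI[of _ "nat (Z - j)"]) auto
    qed
    then have *: "(\<lambda>N. inv_qpoch p (int N + j)) \<longlonglongrightarrow> 1 / L" for j
      unfolding L_def using inv_qpoch_tendsto[OF p(1)] filterlim_compose by blast
    have "(\<lambda>N. qpoch p p (2 * N)) \<longlonglongrightarrow> L"
      unfolding L_def
      by (rule filterlim_compose[OF qpoch_tendsto[OF p(1)]]) (auto intro!: filterlim_subseq strict_monoI)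
    \<comment> \<open>The three factors of the coefficient tend to \<open>L\<close>,
      \<open>1 / L\<close> and \<open>1 / L\<close>.\<close>
    from tendsto_mult[OF tendsto_mult[OF this *[of "- k"]] *[of k]]
    show ?thesis using L by (simp add: jacobi_coeff_def)
  qed
  have sumE: "E summable_on UNIV"
    using Infinite_Sum.abs_summable_on_comparison_test'[OF summable_on_theta_bound[OF q(1) r(3)] norm_E]
    by (rule abs_summable_summable)
  \<comment> \<open>The finite partial sums converge uniformly in \<open>N\<close>, which permits
    exchanging the limit in \<open>N\<close> with the sum over \<open>k\<close>.\<close>
  have "P \<longlonglongrightarrow> (\<Sum>\<^sub>\<infinity>k. E k) * (1 / L)"
  proof (rule swap_uniform_limit')
    show "uniform_limit UNIV (\<lambda>X N. \<Sum>k\<in>X. E k * jacobi_coeff p N k) P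
            (finite_subsets_at_top UNIV)"
    proof (rule Weierstrass_m_test_general')
      show "norm (E k * jacobi_coeff p N k) \<le> norm q powi (k ^ 2) * r ^ nat \<bar>k\<bar> * K" for N k
        unfolding norm_mult using norm_E[of k] norm_coeff[of N k] r by (intro mult_mono) auto
      show "((\<lambda>k. E k * jacobi_coeff p N k) has_sum P N) UNIV" for N
        using finite_jacobi_triple_product[OF q x, of N] by (simp add: E_def P_def p_def)
      show "(\<lambda>k. norm q powi (k ^ 2) * r ^ nat \<bar>k\<bar> * K) summable_on UNIV"
        by (intro summable_on_cmult_left summable_on_theta_bound q r)
    qed
    show "\<forall>\<^sub>F X in finite_subsets_at_top UNIV.
        (\<lambda>N. \<Sum>k\<in>X. E k * jacobi_coeff p N k) \<longlonglongrightarrow> (\<Sum>k\<in>X. E k * (1 / L))"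
      by (intro always_eventually allI tendsto_intros coeff_lim)
    have "((\<lambda>k. E k * (1 / L)) has_sum (\<Sum>\<^sub>\<infinity>k. E k) * (1 / L)) UNIV"
      by (intro has_sum_cmult_left has_sum_infsum sumE)
    then show "((\<lambda>X. \<Sum>k\<in>X. E k * (1 / L)) \<longlongrightarrow> (\<Sum>\<^sub>\<infinity>k. E k) * (1 / L))
                 (finite_subsets_at_top UNIV)"
      by (simp only: has_sum_def)
  qed auto
  moreover have "P \<longlonglongrightarrow> qpoch_inf (x * q) p * qpoch_inf (q / x) p"
    unfolding P_def by (intro tendsto_intros qpoch_tendsto p)
  ultimately have "(\<Sum>\<^sub>\<infinity>k. E k) * (1 / L) = qpoch_inf (x * q) p * qpoch_inf (q / x) p"
    by (rule LIMSEQ_unique)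
  then have "(\<Sum>\<^sub>\<infinity>k. E k) = qpochs_inf [x * q, q / x, q ^ 2] (q ^ 2)"
    using L by (simp add: qpochs_inf_def L_def p_def field_simps)
  then show ?thesis
    using has_sum_infsum[OF sumE] by (simp add: E_def[abs_def])
qed

section \<open>The functional equation of F8\<close>

text \<open>On the ball of radius |z|/2 the norm stays between |z|/2 and 2|z|. This provides one
  \<open>r\<close> for a whole neighbourhood, as the local majorants require.\<close>

lemma cball_half_norm_bounds:
  fixes z w :: complex
  assumes "z \<noteq> 0" "w \<in> cball z (norm z / 2)"
  shows "w \<noteq> 0" "norm w \<le> max (2 * norm z) (2 / norm z)" "1 / norm w \<le> max (2 * norm z) (2 / norm z)"
proof -
  have "norm (z - w) \<le> norm z / 2"
    using assms by (simp add: dist_norm)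
  then have w: "norm w \<ge> norm z / 2" "norm w \<le> 2 * norm z"
    using norm_triangle_ineq2[of z w] norm_triangle_ineq2[of w z] by (simp_all add: norm_minus_commute)
  have "1 / norm w \<le> 1 / (norm z / 2)"
    using w assms by (intro divide_left_mono mult_pos_pos) auto
  then show "w \<noteq> 0" "norm w \<le> max (2 * norm z) (2 / norm z)"
    "1 / norm w \<le> max (2 * norm z) (2 / norm z)"
    using w assms by (auto simp: le_max_iff_disj)
qed

text \<open>The Jacobi theta function with parameter \<open>q ^ 2\<close>, evaluated at
  \<open>z ^ 2\<close>.\<close>

definition theta_prod :: "complex \<Rightarrow> complex \<Rightarrow> complex" where
  "theta_prod q z = qpochs_inf [z ^ 2 * q ^ 2, q ^ 2 / z ^ 2, q ^ 4] (q ^ 4)"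

text \<open>The \<open>reg_\<close> functions are what remains of \<open>\<theta>\<close> times a term of \<open>F8\<close> after the
  denominators have been cancelled, so they make sense at the poles of \<open>F8\<close> as well.\<close>

definition reg_factor :: "complex \<Rightarrow> complex \<Rightarrow> complex" where
  "reg_factor q z = qpoch_inf (- (z * q)) (q ^ 2) * qpoch_inf (- (q / z)) (q ^ 2)"

definition reg_tail :: "complex \<Rightarrow> nat \<Rightarrow> complex \<Rightarrow> complex" where
  "reg_tail q n z = qpoch_inf (z * q ^ (2 * n + 3)) (q ^ 2) * qpoch_inf (q ^ (2 * n + 3) / z) (q ^ 2)"

definition reg_term :: "complex \<Rightarrow> nat \<Rightarrow> complex \<Rightarrow> complex" where
  "reg_term q n z = (-1) ^ n * qpoch q (q ^ 2) n * q ^ ((n + 1) ^ 2) * reg_factor q z * reg_tail q n z"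

definition theta_coeff :: "complex \<Rightarrow> int \<Rightarrow> complex" where
  "theta_coeff q k = (-1) powi (k - 1) * q powi (2 * k ^ 2) / (1 + q powi (4 * k - 1))"

text \<open>An Appell-Lerch type series carrying the \<open>z powi (2 * k)\<close> half of the
  bilateral sum; the other half is \<open>z\<close> times its value at \<open>1 / z\<close>.\<close>

definition half_lerch :: "complex \<Rightarrow> complex \<Rightarrow> complex" where
  "half_lerch q z = (\<Sum>\<^sub>\<infinity>k. theta_coeff q k * z powi (2 * k))"

context
  fixes q :: complex
  assumes q: "0 < norm q" "norm q < 1"
begin

lemma q_nz: "q \<noteq> 0"
  using q by auto

lemma norm_q2: "norm (q ^ 2) < 1"
  using q by (simp add: norm_power power_less_one_iff)

lemma norm_q4: "norm (q ^ 4) < 1"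
  using q by (simp add: norm_power power_less_one_iff)

section \<open>Symmetries of the theta product and cancellation of the poles\<close>

lemma theta_prod_inverse:
  "theta_prod q (1 / z) = theta_prod q z"
  by (simp add: theta_prod_def qpochs_inf_def power_divide mult_ac)

text \<open>The first product loses one factor and the second gains one; their quotient is the
  monomial multiplier.\<close>

lemma theta_prod_shift:
  assumes z: "z \<noteq> 0"
  shows "theta_prod q (q ^ 2 * z) = - theta_prod q z / (q ^ 2 * z ^ 2)"
proof -
  have 1: "qpoch_inf (z ^ 2 * q ^ 2) (q ^ 4)
      = (1 - z ^ 2 * q ^ 2) * qpoch_inf ((q ^ 2 * z) ^ 2 * q ^ 2) (q ^ 4)"
  proof -
    have "z ^ 2 * q ^ 2 * q ^ 4 = (q ^ 2 * z) ^ 2 * q ^ 2"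
      by algebra
    with qpoch_inf_rec[OF norm_q4, of "z ^ 2 * q ^ 2"] show ?thesis by metis
  qed
  have 2: "qpoch_inf (q ^ 2 / (q ^ 2 * z) ^ 2) (q ^ 4)
      = (1 - 1 / (q ^ 2 * z ^ 2)) * qpoch_inf (q ^ 2 / z ^ 2) (q ^ 4)"
  proof -
    have "1 / (q ^ 2 * z ^ 2) * q ^ 4 = q ^ 2 / z ^ 2" "q ^ 2 / (q ^ 2 * z) ^ 2 = 1 / (q ^ 2 * z ^ 2)"
      using z q_nz by (simp_all add: field_simps eval_nat_numeral)
    with qpoch_inf_rec[OF norm_q4, of "1 / (q ^ 2 * z ^ 2)"] show ?thesis by metis
  qed
  have "A * ((1 - 1 / (q ^ 2 * z ^ 2)) * B * C) = - ((1 - z ^ 2 * q ^ 2) * A * (B * C)) / (q ^ 2 * z ^ 2)"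
    for A B C :: complex
    using z q_nz by (simp add: field_simps)
  then show ?thesis
    unfolding theta_prod_def qpochs_inf_def list.map prod_list.Cons 1 2 .
qed

lemma theta_prod_has_sum:
  assumes z: "z \<noteq> 0"
  shows "((\<lambda>k. (-1) powi k * q powi (2 * k ^ 2) * z powi (2 * k)) has_sum theta_prod q z) UNIV"
proof -
  have "((\<lambda>k. (-1) powi k * (q ^ 2) powi (k ^ 2) * (z ^ 2) powi k) has_sum
          qpochs_inf [z ^ 2 * q ^ 2, q ^ 2 / z ^ 2, (q ^ 2) ^ 2] ((q ^ 2) ^ 2)) UNIV"
    using norm_q2 q_nz z by (intro jacobi_triple_product) auto
  then show ?thesis
    by (simp add: theta_prod_def power_int_mult flip: power_mult)
qed

text \<open>This exhibits inside the theta product the infinite completions of the denominators of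
  \<open>F8\<close>.\<close>

lemma theta_prod_factor:
  "theta_prod q z = qpoch_inf (q ^ 4) (q ^ 4) * reg_factor q z *
     (qpoch_inf (z * q) (q ^ 2) * qpoch_inf (q / z) (q ^ 2))"
  using qpoch_inf_square[OF norm_q2, of "z * q"] qpoch_inf_square[OF norm_q2, of "q / z"]
  by (simp add: theta_prod_def qpochs_inf_def reg_factor_def power_mult_distrib power_divide mult_ac
      flip: power_mult)

lemma odd_power_split: "q ^ (2 * n + 1) = q * (q ^ 2) ^ n" "q ^ (2 * n + 3) = q * (q ^ 2) ^ Suc n"
  by (simp_all add: power_add power_mult power2_eq_square power3_eq_cube)

text \<open>The denominator consists of the first \<open>n + 1\<close> factors of two infinite
  products contained in \<open>theta_prod\<close>; what is left of these starts at exponent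
  \<open>2 * n + 3\<close>.\<close>

lemma theta_prod_F8_term:
  assumes z: "z \<noteq> 0" and def: "\<And>n::nat. z * q ^ (2 * n + 1) \<noteq> 1 \<and> q ^ (2 * n + 1) / z \<noteq> 1"
  shows "theta_prod q z * ((-1) ^ n * qpoch q (q ^ 2) n * q ^ ((n + 1) ^ 2)
            / qpochs [z * q, q / z] (q ^ 2) (n + 1))
         = qpoch_inf (q ^ 4) (q ^ 4) * reg_term q n z"
proof -
  have nz: "qpoch (z * q) (q ^ 2) m \<noteq> 0" "qpoch (q / z) (q ^ 2) m \<noteq> 0" for m
    using def unfolding odd_power_split by (auto simp: qpoch_def mult.assoc)
  have "qpoch_inf (z * q) (q ^ 2)
      = qpoch (z * q) (q ^ 2) (n + 1) * qpoch_inf (z * q ^ (2 * n + 3)) (q ^ 2)"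
    using qpoch_inf_split[OF norm_q2, of "z * q" "n + 1"] unfolding odd_power_split by (simp add: mult.assoc)
  moreover have "qpoch_inf (q / z) (q ^ 2)
      = qpoch (q / z) (q ^ 2) (n + 1) * qpoch_inf (q ^ (2 * n + 3) / z) (q ^ 2)"
    using qpoch_inf_split[OF norm_q2, of "q / z" "n + 1"] unfolding odd_power_split by simp
  ultimately show ?thesis
    using nz[of "n + 1"]
    by (simp add: theta_prod_factor reg_term_def reg_tail_def qpochs_def field_simps del: power_Suc)
qed

text \<open>The fourth power comes from the four infinite products in a term, and the geometric
  factor from (n+1)^2 >= n.\<close>

lemma norm_reg_term_le:
  assumes r: "norm z \<le> r" "1 / norm z \<le> r" and z: "z \<noteq> 0"
  shows "norm (reg_term q n z) \<le>
           exp (1 / (1 - norm (q ^ 2))) * (exp (r / (1 - norm (q ^ 2)))) ^ 4 * norm q ^ n"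
proof -
  define d where "d = 1 - norm (q ^ 2)"
  have d: "d > 0" using norm_q2 by (simp add: d_def)
  have r0: "r \<ge> 0" using r(1) norm_ge_zero order_trans by blast
  have P: "norm (qpoch_inf a (q ^ 2)) \<le> exp (r / d)" if "norm a \<le> r" for a
  proof -
    have "norm (qpoch_inf a (q ^ 2)) \<le> exp (norm a / d)"
      unfolding d_def by (rule norm_qpoch_inf_le[OF norm_q2])
    also have "\<dots> \<le> exp (r / d)"
      using that d by (simp add: divide_right_mono)
    finally show ?thesis .
  qed
  have m: "norm (z * q ^ m) \<le> r" "norm (q ^ m / z) \<le> r" for m
  proof -
    have 1: "norm (q ^ m) \<le> 1"
      using q by (simp add: norm_power power_le_one)
    show "norm (z * q ^ m) \<le> r"
      using mult_mono[OF r(1) 1] r0 by (simp add: norm_mult)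
    show "norm (q ^ m / z) \<le> r"
      using mult_mono[OF r(2) 1] r0 by (simp add: norm_divide)
  qed
  have "norm (reg_factor q z) \<le> exp (r / d) * exp (r / d)"
    unfolding reg_factor_def norm_mult using m[of 1] by (intro mult_mono P) auto
  moreover have "norm (reg_tail q n z) \<le> exp (r / d) * exp (r / d)"
    unfolding reg_tail_def norm_mult using m by (intro mult_mono P) auto
  moreover have "norm (qpoch q (q ^ 2) n) \<le> exp (1 / d)"
  proof -
    have "norm (qpoch q (q ^ 2) n) \<le> exp (norm q / d)"
      unfolding d_def by (rule norm_qpoch_le[OF norm_q2])
    also have "\<dots> \<le> exp (1 / d)"
      using q d by (simp add: divide_right_mono)
    finally show ?thesis .
  qed
  moreover have "norm (q ^ ((n + 1) ^ 2)) \<le> norm q ^ n"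
    unfolding norm_power using q by (intro power_decreasing) (auto simp: power2_eq_square)
  ultimately have "norm (reg_term q n z) \<le> 1 * exp (1 / d) * norm q ^ n * (exp (r / d) * exp (r / d))
      * (exp (r / d) * exp (r / d))"
    unfolding reg_term_def norm_mult by (intro mult_mono) (auto simp: norm_power)
  then show ?thesis
    by (simp add: d_def power4_eq_xxxx mult_ac)
qed

lemma reg_term_summable:
  assumes z: "z \<noteq> 0"
  shows "summable (\<lambda>n. norm (reg_term q n z))"
proof (rule summable_comparison_test)
  define r where "r = max (norm z) (1 / norm z)"
  show "\<exists>N. \<forall>n\<ge>N. norm (norm (reg_term q n z)) \<le>
       exp (1 / (1 - norm (q ^ 2))) * (exp (r / (1 - norm (q ^ 2)))) ^ 4 * norm q ^ n"
    using norm_reg_term_le[of z r] z by (auto simp: r_def)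
qed (use q in \<open>intro summable_mult summable_geometric; simp\<close>)

definition reg_sum :: "complex \<Rightarrow> complex" where
  "reg_sum z = (\<Sum>\<^sub>\<infinity>n. reg_term q n z)"

lemma reg_sum_sums:
  assumes z: "z \<noteq> 0"
  shows "(\<lambda>n. reg_term q n z) sums reg_sum z"
proof -
  have "(\<lambda>n. reg_term q n z) summable_on UNIV"
    using reg_term_summable[OF z] by (rule norm_summable_imp_summable_on)
  then show ?thesis
    unfolding reg_sum_def by (intro has_sum_imp_sums has_sum_infsum)
qed

lemma theta_prod_F8:
  assumes z: "z \<noteq> 0" and def: "\<And>n::nat. z * q ^ (2 * n + 1) \<noteq> 1 \<and> q ^ (2 * n + 1) / z \<noteq> 1"
  shows "theta_prod q z * F8 z q = qpoch_inf (q ^ 4) (q ^ 4) * reg_sum z"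
proof -
  define t where "t n = (-1) ^ n * qpoch q (q ^ 2) n * q ^ ((n + 1) ^ 2)
            / qpochs [z * q, q / z] (q ^ 2) (n + 1)" for n
  have "(\<lambda>n. theta_prod q z * t n) sums (qpoch_inf (q ^ 4) (q ^ 4) * reg_sum z)"
    unfolding t_def theta_prod_F8_term[OF assms] by (intro sums_mult reg_sum_sums z)
  \<comment> \<open>Summability of \<open>t\<close> is recovered by dividing by
    \<open>theta_prod q z\<close>; where this vanishes, both sides are \<open>0\<close>.\<close>
  moreover from this have "(\<lambda>n. theta_prod q z * t n) sums (theta_prod q z * suminf t)"
    by (cases "theta_prod q z = 0")
       (auto simp: sums_iff summable_cmult_iff suminf_mult)
  ultimately show ?thesis
    unfolding F8_def t_def[abs_def] by (rule sums_unique2[symmetric])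
qed

lemma holomorphic_reg_sum: "reg_sum holomorphic_on -{0}"
  unfolding reg_sum_def[abs_def]
proof (rule holomorphic_infsum)
  show "reg_term q n holomorphic_on -{0}" for n
    unfolding reg_term_def[abs_def] reg_factor_def reg_tail_def
    by (intro holomorphic_intros norm_q2) auto
  fix z :: complex assume "z \<in> -{0}"
  then have z: "z \<noteq> 0" by simp
  define r where "r = max (2 * norm z) (2 / norm z)"
  define M where "M n = exp (1 / (1 - norm (q ^ 2))) * (exp (r / (1 - norm (q ^ 2)))) ^ 4 * norm q ^ n"
    for n
  have "summable (\<lambda>n. norm (M n))"
    unfolding M_def using q by (simp add: abs_mult summable_mult summable_geometric)
  then have "M summable_on UNIV"
    by (rule norm_summable_imp_summable_on)
  moreover have "norm (reg_term q n w) \<le> M n" if "w \<in> cball z (norm z / 2)" for n w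
    unfolding M_def using cball_half_norm_bounds[OF z that]
    by (intro norm_reg_term_le) (auto simp: r_def)
  moreover have "cball z (norm z / 2) \<subseteq> -{0}"
    using cball_half_norm_bounds[OF z] by auto
  ultimately show "\<exists>d M. 0 < d \<and> cball z d \<subseteq> -{0} \<and> M summable_on UNIV \<and>
      (\<forall>k\<in>UNIV. \<forall>w\<in>cball z d. norm (reg_term q k w) \<le> M k)"
    using z by (intro exI[of _ "norm z / 2"] exI[of _ M]) auto
qed auto


section \<open>The shift of \<open>z\<close> by \<open>q ^ 2\<close> and creative
  telescoping\<close>

lemma reg_factor_shift:
  assumes z: "z \<noteq> 0"
  shows "reg_factor q (q ^ 2 * z) = reg_factor q z / (q * z)"
proof -
  have 1: "qpoch_inf (- (z * q)) (q ^ 2) = (1 + z * q) * qpoch_inf (- (q ^ 2 * z * q)) (q ^ 2)"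
    using qpoch_inf_rec[OF norm_q2, of "- (z * q)"] by (simp add: mult_ac)
  have 2: "qpoch_inf (- (q / (q ^ 2 * z))) (q ^ 2) = (1 + 1 / (q * z)) * qpoch_inf (- (q / z)) (q ^ 2)"
  proof -
    have "- (q / (q ^ 2 * z)) = - (1 / (q * z))" "- (1 / (q * z)) * q ^ 2 = - (q / z)"
      using z q_nz by (simp_all add: power2_eq_square)
    with qpoch_inf_rec[OF norm_q2, of "- (1 / (q * z))"] show ?thesis by simp
  qed
  have "A * ((1 + 1 / (q * z)) * B) = (1 + z * q) * A * B / (q * z)" for A B :: complex
    using z q_nz by (simp add: field_simps)
  then show ?thesis
    unfolding reg_factor_def 1 2 .
qed

lemma reg_tail_rec:
  "reg_tail q n z = (1 - z * q ^ 3 * q ^ (2 * n)) * (1 - q ^ 3 * q ^ (2 * n) / z) * reg_tail q (Suc n) z"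
proof -
  have "qpoch_inf (z * q ^ (2 * n + 3)) (q ^ 2)
      = (1 - z * q ^ (2 * n + 3)) * qpoch_inf (z * q ^ (2 * Suc n + 3)) (q ^ 2)"
    using qpoch_inf_rec[OF norm_q2, of "z * q ^ (2 * n + 3)"]
    by (simp add: mult.assoc flip: power_add)
  moreover have "qpoch_inf (q ^ (2 * n + 3) / z) (q ^ 2)
      = (1 - q ^ (2 * n + 3) / z) * qpoch_inf (q ^ (2 * Suc n + 3) / z) (q ^ 2)"
    using qpoch_inf_rec[OF norm_q2, of "q ^ (2 * n + 3) / z"]
    by (simp flip: power_add)
  ultimately show ?thesis
    unfolding reg_tail_def by (simp add: power_add mult_ac)
qed

text \<open>The shift moves the two tails in opposite directions. The result is expressed through
  \<open>reg_tail q (Suc n) z\<close>, as in \<open>reg_tail_rec\<close>, to have a common factor in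
  the telescoping identity.\<close>

lemma reg_tail_shift:
  assumes z: "z \<noteq> 0"
  shows "reg_tail q n (q ^ 2 * z)
       = (1 - q * q ^ (2 * n) / z) * (1 - q ^ 3 * q ^ (2 * n) / z) * reg_tail q (Suc n) z"
proof -
  have 0: "q ^ (2 * n + 3) / (q ^ 2 * z) = q * q ^ (2 * n) / z"
    using z q_nz by (simp add: field_simps power_add eval_nat_numeral)
  have 1: "qpoch_inf (q ^ (2 * n + 3) / (q ^ 2 * z)) (q ^ 2)
     = (1 - q * q ^ (2 * n) / z) * qpoch_inf (q ^ (2 * n + 3) / z) (q ^ 2)"
    using qpoch_inf_rec[OF norm_q2, of "q * q ^ (2 * n) / z"]
    unfolding 0 by (simp add: power_add eval_nat_numeral mult_ac)
  have 2: "qpoch_inf (q ^ (2 * n + 3) / z) (q ^ 2)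
      = (1 - q ^ 3 * q ^ (2 * n) / z) * qpoch_inf (q ^ (2 * Suc n + 3) / z) (q ^ 2)"
    using qpoch_inf_rec[OF norm_q2, of "q ^ (2 * n + 3) / z"]
    by (simp add: power_add eval_nat_numeral mult_ac)
  have 3: "q ^ 2 * z * q ^ (2 * n + 3) = z * q ^ (2 * Suc n + 3)"
    by (simp add: power_add eval_nat_numeral mult_ac)
  show ?thesis
    unfolding reg_tail_def 1 2 3 by simp
qed

text \<open>Zeilberger-type certificate for the terms of \<open>F8\<close>; the rational prefactor was found by an ansatz.\<close>

definition telescoper :: "nat \<Rightarrow> complex \<Rightarrow> complex" where
  "telescoper n z = (q * z - 1 / (q * z)) * (1 - q * q ^ (2 * n) / z) * reg_term q n z"

lemma telescoper_Suc_diff: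
  assumes z: "z \<noteq> 0"
  shows "telescoper (Suc n) z - telescoper n z
       = q * (1 - z) * reg_term q n z + (1 - q ^ 2 * z) * reg_term q n (q ^ 2 * z)"
proof -
  define X where "X = q ^ (2 * n)"
  define u where "u = 1 / z"
  define v where "v = 1 / q"
  have uv: "z * u = 1" "q * v = 1" using z q_nz by (auto simp: u_def v_def)
  \<comment> \<open>\<open>Z\<close> is the part shared by all the terms involved; \<open>u\<close>
    and \<open>v\<close> replace \<open>1 / z\<close> and \<open>1 / q\<close> so that the rest is
    polynomial.\<close>
  define Z where "Z = (-1) ^ n * qpoch q (q ^ 2) n * q ^ ((n + 1) ^ 2) * reg_factor q z
                        * reg_tail q (Suc n) z * (1 - q ^ 3 * X * u)"
  have XS: "q ^ (2 * Suc n) = q ^ 2 * X"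
    by (simp add: X_def power2_eq_square)
  have div: "a / z = a * u" "1 / (q * z) = v * u" "a / (q * z) = a * v * u" for a
    by (simp_all add: u_def v_def)
  have t0: "reg_term q n z = (1 - z * q ^ 3 * X) * Z"
    unfolding reg_term_def reg_tail_rec[of n z] Z_def by (simp add: X_def div mult_ac)
  have t1: "reg_term q n (q ^ 2 * z) = (1 - q * X * u) * (v * u) * Z"
    unfolding reg_term_def reg_tail_shift[OF z, of n, folded X_def] reg_factor_shift[OF z] Z_def
    by (simp add: div mult_ac)
  have "(Suc n + 1) ^ 2 = (n + 1) ^ 2 + (3 + 2 * n)"
    by (simp add: power2_eq_square)
  then have qp: "q ^ ((Suc n + 1) ^ 2) = q ^ ((n + 1) ^ 2) * (q ^ 3 * X)"
    by (simp only: power_add X_def)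
  have "qpoch q (q ^ 2) (Suc n) = (1 - q * X) * qpoch q (q ^ 2) n"
    by (simp add: qpoch_Suc X_def power_mult)
  \<comment> \<open>The factor \<open>1 - q ^ 3 * X * u\<close> comes from
    \<open>telescoper (Suc n) z\<close> and is already part of \<open>Z\<close>, so
    \<open>reg_tail q (Suc n) z\<close> need not be expanded further.\<close>
  then have t2: "(1 - q ^ 3 * X * u) * reg_term q (Suc n) z = - ((1 - q * X) * q ^ 3 * X) * Z"
    unfolding reg_term_def qp Z_def by simp
  have "telescoper (Suc n) z
      = (q * z - v * u) * ((1 - q ^ 3 * X * u) * reg_term q (Suc n) z)"
    unfolding telescoper_def XS div by (simp add: power2_eq_square power3_eq_cube mult_ac)
  then have T1: "telescoper (Suc n) z = (q * z - v * u) * (- ((1 - q * X) * q ^ 3 * X) * Z)"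
    unfolding t2 .
  have T0: "telescoper n z = (q * z - v * u) * ((1 - q * X * u) * ((1 - z * q ^ 3 * X) * Z))"
    unfolding telescoper_def t0 div by (simp add: X_def mult_ac)
  \<comment> \<open>The certificate with \<open>Z\<close> divided out, valid modulo
    \<open>z * u = 1\<close> and \<open>q * v = 1\<close>.\<close>
  have "(q * z - v * u) * (- ((1 - q * X) * q ^ 3 * X)) - (q * z - v * u) * ((1 - q * X * u) * (1 - z * q ^ 3 * X))
      = q * (1 - z) * (1 - z * q ^ 3 * X) + (1 - q ^ 2 * z) * ((1 - q * X * u) * (v * u))"
    using uv by algebra
  moreover have "x * (b * Z) - x * (c * (d * Z)) = y * (d * Z) + s * (c * w * Z)"
    if "x * b - x * (c * d) = y * d + s * (c * w)" for x b c d y s w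
    using that by algebra
  ultimately show ?thesis
    unfolding T0 T1 t0 t1 by blast
qed

text \<open>Summing the certificate leaves \<open>- telescoper 0 z\<close>, because the telescoper
  tends to \<open>0\<close>. This boundary term is a multiple of the theta product.\<close>

lemma reg_sum_functional_equation:
  assumes z: "z \<noteq> 0"
  shows "qpoch_inf (q ^ 4) (q ^ 4) * (q * (1 - z) * reg_sum z + (1 - q ^ 2 * z) * reg_sum (q ^ 2 * z))
       = (q + 1 / z) * theta_prod q z"
proof -
  have z': "q ^ 2 * z \<noteq> 0" using z q_nz by simp
  have "(\<lambda>n. reg_term q n z) \<longlonglongrightarrow> 0"
    by (rule summable_LIMSEQ_zero[OF summable_norm_cancel[OF reg_term_summable[OF z]]])
  moreover have "(\<lambda>n. (q ^ 2) ^ n) \<longlonglongrightarrow> 0"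
    by (rule LIMSEQ_power_zero[OF norm_q2])
  ultimately have "(\<lambda>n. (q * z - 1 / (q * z)) * (1 - q * (q ^ 2) ^ n / z) * reg_term q n z)
           \<longlonglongrightarrow> (q * z - 1 / (q * z)) * (1 - q * 0 / z) * 0"
    using z by (intro tendsto_mult tendsto_diff tendsto_divide tendsto_const)
  then have "(\<lambda>n. telescoper n z) \<longlonglongrightarrow> 0"
    by (simp add: telescoper_def power_mult)
  then have "(\<lambda>n. telescoper (Suc n) z - telescoper n z) sums (0 - telescoper 0 z)"
    by (rule telescope_sums)
  moreover have "(\<lambda>n. telescoper (Suc n) z - telescoper n z) sums
      (q * (1 - z) * reg_sum z + (1 - q ^ 2 * z) * reg_sum (q ^ 2 * z))"
    unfolding telescoper_Suc_diff[OF z] by (intro sums_add sums_mult reg_sum_sums z z')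
  ultimately have eq: "q * (1 - z) * reg_sum z + (1 - q ^ 2 * z) * reg_sum (q ^ 2 * z) = - telescoper 0 z"
    by (metis diff_0 sums_unique2)
  have "qpoch_inf (z * q) (q ^ 2) * qpoch_inf (q / z) (q ^ 2)
      = (1 - z * q) * (1 - q / z) * reg_tail q 0 z"
    using qpoch_inf_rec[OF norm_q2, of "z * q"] qpoch_inf_rec[OF norm_q2, of "q / z"]
    by (simp add: reg_tail_def power2_eq_square power3_eq_cube mult_ac)
  then have theta: "theta_prod q z = qpoch_inf (q ^ 4) (q ^ 4) * reg_factor q z
      * ((1 - z * q) * (1 - q / z) * reg_tail q 0 z)"
    using theta_prod_factor[of z] by simp
  have start: "telescoper 0 z
      = (q * z - 1 / (q * z)) * (1 - q / z) * (q * reg_factor q z * reg_tail q 0 z)"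
    by (simp add: telescoper_def reg_term_def)
  \<comment> \<open>This extracts \<open>1 - z * q\<close>, the one factor that the boundary term
    lacks to complete the products in \<open>theta_prod\<close>.\<close>
  have "- ((q * z - 1 / (q * z)) * q) = (q + 1 / z) * (1 - z * q)"
    using z q_nz by (simp add: field_simps power2_eq_square)
  then have "P * - ((q * z - 1 / (q * z)) * (1 - c) * (q * r * t))
      = (q + 1 / z) * (P * r * ((1 - z * q) * (1 - c) * t))" for P c r t
    by algebra
  then show ?thesis
    unfolding eq theta start .
qed

end

section \<open>The bilateral series\<close>

context
  fixes q :: complex
  assumes q: "0 < norm q" "norm q < 1"
begin

text \<open>The exponent is at least 3 for \<open>k \<ge> 1\<close> and at most -1 otherwise, so the
  power has norm at most |q| or at least 1/|q|. The bound is uniform in \<open>k\<close>.\<close>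

lemma norm_theta_denom_ge: "1 - norm q \<le> norm (1 + q powi (4 * k - 1))"
proof (cases "k \<ge> 1")
  case True
  define m where "m = nat (4 * k - 2)"
  have m: "4 * k - 1 = int (Suc m)"
    using True by (simp add: m_def)
  have "norm (q powi (4 * k - 1)) \<le> norm q"
    unfolding m power_int_of_nat norm_power
    using q power_decreasing[of 1 "Suc m" "norm q"] by simp
  then show ?thesis
    using norm_triangle_ineq2[of 1 "- (q powi (4 * k - 1))"] by simp
next
  case False
  define m where "m = nat (- 4 * k)"
  have m: "4 * k - 1 = - int (Suc m)"
    using False by (simp add: m_def)
  have "1 \<le> norm (inverse q ^ Suc m) * norm q"
  proof -
    have "1 \<le> norm (inverse q) ^ m"
      using q by (intro one_le_power) (simp add: norm_inverse one_le_inverse)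
    moreover have "norm (inverse q ^ Suc m) * norm q = norm (inverse q) ^ m"
      using q by (simp add: norm_power norm_mult norm_inverse)
    ultimately show ?thesis by simp
  qed
  then have "1 \<le> norm (q powi (4 * k - 1)) * norm q"
    by (simp only: m power_int_minus power_int_of_nat power_inverse)
  note ge = this
  \<comment> \<open>1/|q| >= 2 - |q| is a form of (1 - |q|)^2 >= 0.\<close>
  have "2 - norm q \<le> norm (q powi (4 * k - 1))"
  proof (rule ccontr)
    assume "\<not> ?thesis"
    then have "norm (q powi (4 * k - 1)) * norm q < (2 - norm q) * norm q"
      using q by (intro mult_strict_right_mono) auto
    moreover have "(2 - norm q) * norm q \<le> 1"
      using zero_le_power2[of "1 - norm q"] by (simp add: power2_eq_square algebra_simps)
    ultimately show False
      using ge by linarith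
  qed
  then show ?thesis
    using norm_triangle_ineq2[of "q powi (4 * k - 1)" "-1"]
    by (simp add: add.commute)
qed

lemma theta_denom_nonzero: "1 + q powi (4 * k - 1) \<noteq> 0"
  using norm_theta_denom_ge[of k] q by auto

lemma norm_theta_coeff_le:
  assumes "norm z \<le> r" "1 / norm z \<le> r" "z \<noteq> 0"
  shows "norm (theta_coeff q k * z powi (2 * k))
           \<le> 1 / (1 - norm q) * (norm (q ^ 2) powi (k ^ 2) * (r ^ 2) ^ nat \<bar>k\<bar>)"
proof -
  have pw: "z powi (2 * k) = (z ^ 2) powi k" "q powi (2 * k ^ 2) = (q ^ 2) powi (k ^ 2)"
    by (simp_all add: power_int_mult)
  have "norm (z ^ 2) \<le> r ^ 2"
    unfolding norm_power using assms by (intro power_mono) auto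
  moreover have "1 / norm (z ^ 2) \<le> r ^ 2"
    using power_mono[OF assms(2), of 2] by (simp add: norm_power power_divide)
  ultimately have 1: "norm (z powi (2 * k)) \<le> (r ^ 2) ^ nat \<bar>k\<bar>"
    unfolding pw using assms by (intro norm_power_int_le) auto
  have "norm (theta_coeff q k) = norm (q ^ 2) powi (k ^ 2) / norm (1 + q powi (4 * k - 1))"
    unfolding theta_coeff_def pw by (simp add: norm_divide norm_mult norm_power_int)
  also have "\<dots> \<le> norm (q ^ 2) powi (k ^ 2) / (1 - norm q)"
    using norm_theta_denom_ge[of k] q
    by (intro divide_left_mono mult_pos_pos) (auto simp: theta_denom_nonzero)
  finally show ?thesis
    unfolding norm_mult using mult_mono[OF _ 1] q by fastforce
qed

lemma summable_on_half_lerch_bound: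
  assumes "r \<ge> 0"
  shows "(\<lambda>k. 1 / (1 - norm q) * (norm (q ^ 2) powi (k ^ 2) * (r ^ 2) ^ nat \<bar>k\<bar>)) summable_on UNIV"
  using norm_q2[OF q] assms by (intro summable_on_cmult_right summable_on_theta_bound) auto

lemma half_lerch_has_sum:
  assumes z: "z \<noteq> 0"
  shows "((\<lambda>k. theta_coeff q k * z powi (2 * k)) has_sum half_lerch q z) UNIV"
proof -
  define r where "r = max (norm z) (1 / norm z)"
  have r: "norm z \<le> r" "1 / norm z \<le> r" "r \<ge> 0"
    by (auto simp: r_def le_max_iff_disj)
  have "(\<lambda>k. norm (theta_coeff q k * z powi (2 * k))) summable_on UNIV"
    by (rule Infinite_Sum.abs_summable_on_comparison_test'[OF summable_on_half_lerch_bound[OF r(3)]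
          norm_theta_coeff_le[OF r(1,2) z]])
  then show ?thesis
    unfolding half_lerch_def by (rule has_sum_infsum[OF abs_summable_summable])
qed

lemma holomorphic_half_lerch: "half_lerch q holomorphic_on -{0}"
  unfolding half_lerch_def[abs_def]
proof (rule holomorphic_infsum)
  show "(\<lambda>z. theta_coeff q k * z powi (2 * k)) holomorphic_on -{0}" for k
    by (intro holomorphic_intros) auto
  fix z :: complex assume "z \<in> -{0}"
  then have z: "z \<noteq> 0" by simp
  define r where "r = max (2 * norm z) (2 / norm z)"
  define M where "M k = 1 / (1 - norm q) * (norm (q ^ 2) powi (k ^ 2) * (r ^ 2) ^ nat \<bar>k\<bar>)" for k :: int
  have "M summable_on UNIV"
    unfolding M_def by (rule summable_on_half_lerch_bound) (auto simp: r_def le_max_iff_disj)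
  moreover have "norm (theta_coeff q k * w powi (2 * k)) \<le> M k" if "w \<in> cball z (norm z / 2)" for k w
    unfolding M_def using cball_half_norm_bounds[OF z that]
    by (intro norm_theta_coeff_le) (auto simp: r_def)
  moreover have "cball z (norm z / 2) \<subseteq> -{0}"
    using cball_half_norm_bounds[OF z] by auto
  ultimately show "\<exists>d M. 0 < d \<and> cball z d \<subseteq> -{0} \<and> M summable_on UNIV \<and>
      (\<forall>k\<in>UNIV. \<forall>w\<in>cball z d. norm (theta_coeff q k * w powi (2 * k)) \<le> M k)"
    using z by (intro exI[of _ "norm z / 2"] exI[of _ M]) auto
qed auto

text \<open>The shift multiplies the \<open>k\<close>-th term by
  \<open>q * q powi (4 * k - 1)\<close>, so the combination produces \<open>q\<close> times the
  denominator of \<open>theta_coeff\<close>. After cancellation the theta series remains.\<close>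

lemma half_lerch_functional_equation:
  assumes z: "z \<noteq> 0"
  shows "half_lerch q (q ^ 2 * z) + q * half_lerch q z = - q * theta_prod q z"
proof -
  have nz: "q \<noteq> 0" using q by auto
  have z': "q ^ 2 * z \<noteq> 0" using z nz by simp
  have "((\<lambda>k. theta_coeff q k * (q ^ 2 * z) powi (2 * k) + q * (theta_coeff q k * z powi (2 * k)))
          has_sum (half_lerch q (q ^ 2 * z) + q * half_lerch q z)) UNIV"
    by (intro has_sum_add has_sum_cmult_right half_lerch_has_sum z z')
  also have "(\<lambda>k. theta_coeff q k * (q ^ 2 * z) powi (2 * k) + q * (theta_coeff q k * z powi (2 * k)))
      = (\<lambda>k. - q * ((-1) powi k * q powi (2 * k ^ 2) * z powi (2 * k)))"
  proof
    fix k :: int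
    have "(q ^ 2) powi (2 * k) = q powi (4 * k)"
      using power_int_mult[of q 2 "2 * k"] by simp
    then have "(q ^ 2 * z) powi (2 * k) = q powi (4 * k) * z powi (2 * k)"
      by (simp add: power_int_mult_distrib)
    moreover have "q powi (4 * k) = q * q powi (4 * k - 1)"
      using nz by (simp add: power_int_diff)
    ultimately have "theta_coeff q k * (q ^ 2 * z) powi (2 * k) + q * (theta_coeff q k * z powi (2 * k))
        = theta_coeff q k * (1 + q powi (4 * k - 1)) * (q * z powi (2 * k))"
      by (simp add: algebra_simps)
    also have "theta_coeff q k * (1 + q powi (4 * k - 1)) = (-1) powi (k - 1) * q powi (2 * k ^ 2)"
      by (simp add: theta_coeff_def theta_denom_nonzero)
    also have "(-1 :: complex) powi (k - 1) = - ((-1) powi k)"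
      by (simp add: power_int_diff)
    finally show "theta_coeff q k * (q ^ 2 * z) powi (2 * k) + q * (theta_coeff q k * z powi (2 * k))
      = - q * ((-1) powi k * q powi (2 * k ^ 2) * z powi (2 * k))"
      by simp
  qed
  finally show ?thesis
    using has_sum_cmult_right[OF theta_prod_has_sum[OF q z], of "- q"] has_sum_unique by blast
qed

text \<open>\<open>H\<close> and \<open>K\<close> obey the same inhomogeneous equation, so their
  difference falls under the uniqueness principle with \<open>p = q ^ 2\<close> and
  \<open>c = - q\<close>.\<close>

lemma reg_sum_eq_half_lerch:
  assumes z: "z \<noteq> 0"
  shows "(1 - z) * (qpoch_inf (q ^ 4) (q ^ 4) * reg_sum q z) = z * half_lerch q (1 / z) - half_lerch q z"
proof -
  have nz: "q \<noteq> 0" using q by auto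
  define H where "H z = (1 - z) * (qpoch_inf (q ^ 4) (q ^ 4) * reg_sum q z)" for z
  define K where "K z = z * half_lerch q (1 / z) - half_lerch q z" for z
  have H: "H (q ^ 2 * z) + q * H z = (q + 1 / z) * theta_prod q z" if "z \<noteq> 0" for z
    using reg_sum_functional_equation[OF q that] by (simp add: H_def algebra_simps)
  have K: "K (q ^ 2 * z) + q * K z = (q + 1 / z) * theta_prod q z" if z: "z \<noteq> 0" for z
  proof -
    \<comment> \<open>The equation of \<open>half_lerch\<close> at \<open>y\<close> links its values
      at \<open>1 / z\<close> and \<open>1 / (q ^ 2 * z)\<close>, which are those entering
      \<open>K z\<close> and \<open>K (q ^ 2 * z)\<close>.\<close>
    define y where "y = 1 / (q ^ 2 * z)"
    have y: "y \<noteq> 0" "q ^ 2 * y = 1 / z"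
      using z nz by (auto simp: y_def)
    have "theta_prod q y = - theta_prod q z / (q ^ 2 * z ^ 2)"
      unfolding y_def theta_prod_inverse[OF q] by (rule theta_prod_shift[OF q z])
    then have "half_lerch q (1 / z) + q * half_lerch q y = q * theta_prod q z / (q ^ 2 * z ^ 2)"
      using half_lerch_functional_equation[OF y(1)] by (simp add: y(2))
    then have eq: "q * z * (half_lerch q (1 / z) + q * half_lerch q y) = theta_prod q z / z"
      using z nz by (simp add: power2_eq_square)
    have "q ^ 2 * z * b - d + q * (z * a - c) = q * t + s"
      if "q * z * (a + q * b) = s" "d + q * c = - q * t" for a b c d s t
    proof -
      have "q ^ 2 * z * b - d + q * (z * a - c) = q * z * (a + q * b) - (d + q * c)"
        by (simp add: power2_eq_square algebra_simps)
      then show ?thesis using that by simp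
    qed
    from this[OF eq half_lerch_functional_equation[OF z]] show ?thesis
      by (simp add: K_def y_def distrib_right)
  qed
  have "H z - K z = 0"
  proof (rule holomorphic_eigenfunction_eq_0[where f = "\<lambda>z. H z - K z" and p = "q ^ 2" and c = "- q"])
    have "half_lerch q \<circ> (\<lambda>z. 1 / z) holomorphic_on -{0}"
      by (rule holomorphic_on_compose_gen[OF _ holomorphic_half_lerch]) (auto intro!: holomorphic_intros)
    then show "(\<lambda>z. H z - K z) holomorphic_on -{0}"
      unfolding H_def K_def using holomorphic_reg_sum[OF q] holomorphic_half_lerch
      by (intro holomorphic_intros) (auto simp: o_def)
    show "H (q ^ 2 * z) - K (q ^ 2 * z) = - q * (H z - K z)" if "z \<noteq> 0" for z
      using H[OF that] K[OF that] by algebra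
    show "norm (q ^ 2) < norm (- q)"
      using q by (simp add: norm_mult power2_eq_square)
  qed (use q nz z in auto)
  then show ?thesis
    by (simp add: H_def K_def)
qed

end

section \<open>Combining the two halves and dividing by 1 - z\<close>

theorem theorem3p6:
  fixes q z :: complex
  assumes q: "0 < norm q" "norm q < 1"
    and z: "z \<noteq> 0" "z \<noteq> 1"
    and F8_defined: "\<And>n::nat. z * q ^ (2 * n + 1) \<noteq> 1 \<and> q ^ (2 * n + 1) / z \<noteq> 1"
  shows "qpochs_inf [z^2 * q^2, q^2 / z^2, q^4] (q^4) * F8 z q =
         (\<Sum>\<^sub>\<infinity>k::int. (-1) powi (k - 1) * q powi (2 * k^2) / (1 + q powi (4 * k - 1))
                   * ((z powi (1 - 2 * k) - z powi (2 * k)) / (1 - z)))"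
proof -
  have "((\<lambda>k. (z * (theta_coeff q k * (1 / z) powi (2 * k)) + - (theta_coeff q k * z powi (2 * k))) / (1 - z))
          has_sum ((z * half_lerch q (1 / z) + - half_lerch q z) / (1 - z))) UNIV"
    using z by (intro has_sum_divide_const has_sum_add has_sum_uminusI has_sum_cmult_right half_lerch_has_sum q) auto
  also have "(\<lambda>k. (z * (theta_coeff q k * (1 / z) powi (2 * k)) + - (theta_coeff q k * z powi (2 * k))) / (1 - z))
      = (\<lambda>k. (-1) powi (k - 1) * q powi (2 * k^2) / (1 + q powi (4 * k - 1))
                   * ((z powi (1 - 2 * k) - z powi (2 * k)) / (1 - z)))"
  proof
    fix k :: int
    \<comment> \<open>This turns \<open>z * half_lerch q (1 / z)\<close> into the
      \<open>z powi (1 - 2 * k)\<close> half of the series.\<close>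
    have "z * (1 / z) powi (2 * k) = z powi (1 - 2 * k)"
      using z by (simp add: power_int_diff power_int_divide_distrib)
    then have "z * (theta_coeff q k * (1 / z) powi (2 * k)) = theta_coeff q k * z powi (1 - 2 * k)"
      by (simp add: mult_ac)
    then show "(z * (theta_coeff q k * (1 / z) powi (2 * k)) + - (theta_coeff q k * z powi (2 * k))) / (1 - z)
       = (-1) powi (k - 1) * q powi (2 * k^2) / (1 + q powi (4 * k - 1))
                   * ((z powi (1 - 2 * k) - z powi (2 * k)) / (1 - z))"
      by (simp add: theta_coeff_def right_diff_distrib)
  qed
  finally have "(\<Sum>\<^sub>\<infinity>k::int. (-1) powi (k - 1) * q powi (2 * k^2) / (1 + q powi (4 * k - 1))
                   * ((z powi (1 - 2 * k) - z powi (2 * k)) / (1 - z)))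
      = (z * half_lerch q (1 / z) + - half_lerch q z) / (1 - z)"
    by (rule infsumI)
  also have "\<dots> = qpoch_inf (q ^ 4) (q ^ 4) * reg_sum q z"
    using reg_sum_eq_half_lerch[OF q z(1)] z(2) by (simp add: field_simps)
  also have "\<dots> = theta_prod q z * F8 z q"
    using theta_prod_F8[OF q z(1) F8_defined] by simp
  finally show ?thesis
    by (simp add: theta_prod_def)
qed

end
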